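(* There is an infinite sequence $\vec\beta=(\beta_1,\beta_2,\dots)\in(2^\omega)^\omega$ of proper sequences such that for all $n>0$ and all $n$-dimensional truth-tables $F,G\colon\{0,1\}^n\to\{0,1\}$ the following are equivalent: (1) $s^G_{\vec\beta\upharpoonright n}\le_{sW} s^F_{\vec\beta\upharpoonright n}$; (2) $s^G_{\vec\beta\upharpoonright n}\le_{W} s^F_{\vec\beta\upharpoonright n}$; (3) there exist $k\ge 0$, $\vec i=(i_1,\dots,i_k)\in\{1,\dots,n\}^k$ with pairwise different entries, and $\vec b=(b_1,\dots,b_k)\in\{0,1\}^k$ such that $G=F^{\vec b}_{\vec i}$ or $G=1-F^{\vec b}_{\vec i}$. Furthermore, $\vec\beta$ can be chosen so that, viewing each $\beta_j$ as (the characteristic sequence of) a subset of $\omega$, $\beta_j\equiv_1\beta_k$ for all $j,k$.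
   Context: Cantor space $2^\omega$ carries the lexicographic order $<_{lex}$. For $\alpha\in2^\omega$, $s_\alpha\colon 2^\omega\to\{0,1\}$ is $s_\alpha(x)=0$ if $x<_{lex}\alpha$ and $s_\alpha(x)=1$ if $x\ge_{lex}\alpha$. A sequence is proper if it contains infinitely many $1$'s. For a truth-table $F\colon\{0,1\}^n\to\{0,1\}$ and $\alpha_1,\dots,\alpha_n\in2^\omega$, $s^F_{\alpha_1,\dots,\alpha_n}(x_1,\dots,x_n)=F(s_{\alpha_1}(x_1),\dots,s_{\alpha_n}(x_n))$, and $s^F_{\vec\beta\upharpoonright n}$ means $s^F_{\beta_1,\dots,\beta_n}$. For $1\le i\le n$ and $b\in\{0,1\}$, $p^b_i\colon\{0,1\}^n\to\{0,1\}^n$ replaces the $i$-th entry of its input by $b$ and leaves the others unchanged; $F^{\vec b}_{\vec i}=F\circ p^{b_1}_{i_1}\circ\dots\circ p^{b_k}_{i_k}$. $f\le_W g$ means there are computable functionals $\Phi,\Psi$ with $f(x)=\Psi(x,g(\Phi(x)))$ for all $x$ in the domain of $f$; $f\le_{sW}g$ means $f(x)=\Psi(g(\Phi(x)))$. $\equiv_1$ is one-one equivalence of sets of natural numbers. *)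

theory Defs
  imports "HOL-Library.Fun_Lexorder"
begin

type_synonym cantor = "nat \<Rightarrow> bool"

definition proper :: "cantor \<Rightarrow> bool" where
  "proper x \<longleftrightarrow> infinite {k. x k}"


subsection \<open>The functions \<open>s\<^sub>\<alpha>\<close> and their truth-table combinations\<close>

text \<open>
  The values 0 and 1 are \<^term>\<open>False\<close> and \<^term>\<open>True\<close>, and \<^const>\<open>less_fun\<close> is the strict
  lexicographic order, which is total on Cantor space.  An n-tuple is a list of length n, and its
  coordinates are numbered from 0.  A truth-table of dimension n is a function on
  \<^typ>\<open>bool list\<close> of which only the values at lists of length n matter.
\<close>

definition cut :: "cantor \<Rightarrow> cantor \<Rightarrow> bool" where
  "cut \<alpha> x \<longleftrightarrow> \<not> less_fun x \<alpha>"

definition tt_cut :: "(bool list \<Rightarrow> bool) \<Rightarrow> cantor list \<Rightarrow> cantor list \<Rightarrow> bool" where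
  "tt_cut F \<alpha>s xs = F (map2 cut \<alpha>s xs)"

definition set_coord :: "nat \<Rightarrow> bool \<Rightarrow> bool list \<Rightarrow> bool list" where
  "set_coord i b v = v[i := b]"

text \<open>
  \<open>tt_fix F [i\<^sub>1, \<dots>, i\<^sub>k] [b\<^sub>1, \<dots>, b\<^sub>k]\<close> is
  \<open>F \<circ> set_coord i\<^sub>1 b\<^sub>1 \<circ> \<dots> \<circ> set_coord i\<^sub>k b\<^sub>k\<close>.
\<close>

definition tt_fix :: "(bool list \<Rightarrow> bool) \<Rightarrow> nat list \<Rightarrow> bool list \<Rightarrow> bool list \<Rightarrow> bool" where
  "tt_fix F ivec bvec v = F (foldr (\<lambda>(i, b). set_coord i b) (zip ivec bvec) v)"


subsection \<open>Computability relative to finitely many points of Cantor space\<close>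

text \<open>
  Partial recursive functions, given by programs for Kleene's schemes, in which
  \<open>Query i\<close> reads one digit of the \<open>i\<close>-th point of the input tuple.
\<close>

datatype prog =
    Zero
  | Succ
  | Proj nat
  | Query nat
  | Comp prog "prog list"
  | PrimRec prog prog
  | Mu prog

text \<open>\<open>computes xs p as v\<close>: program \<open>p\<close> with input points \<open>xs\<close> halts on arguments \<open>as\<close> with value \<open>v\<close>.\<close>

inductive computes :: "cantor list \<Rightarrow> prog \<Rightarrow> nat list \<Rightarrow> nat \<Rightarrow> bool" for xs :: "cantor list" where
  Zero: "computes xs Zero as 0"
| Succ: "computes xs Succ [a] (Suc a)"
| Proj: "i < length as \<Longrightarrow> computes xs (Proj i) as (as ! i)"
| Query: "i < length xs \<Longrightarrow> computes xs (Query i) [a] (of_bool ((xs ! i) a))"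
| Comp: "list_all2 (\<lambda>q r. computes xs q as r) qs rs \<Longrightarrow> computes xs p rs v \<Longrightarrow>
    computes xs (Comp p qs) as v"
| PrimRec_0: "computes xs p as v \<Longrightarrow> computes xs (PrimRec p q) (0 # as) v"
| PrimRec_Suc: "computes xs (PrimRec p q) (a # as) r \<Longrightarrow> computes xs q (a # r # as) v \<Longrightarrow>
    computes xs (PrimRec p q) (Suc a # as) v"
| Mu: "computes xs p (a # as) 0 \<Longrightarrow> (\<And>c. c < a \<Longrightarrow> \<exists>w. computes xs p (c # as) (Suc w)) \<Longrightarrow>
    computes xs (Mu p) as a"

inductive_cases computes_elims:
  "computes xs Zero as v"
  "computes xs Succ as v"
  "computes xs (Proj i) as v"
  "computes xs (Query i) as v"
  "computes xs (Comp p qs) as v"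
  "computes xs (PrimRec p q) (0 # as) v"
  "computes xs (PrimRec p q) (Suc a # as) v"
  "computes xs (Mu p) as v"

lemma computes_deterministic:
  "computes xs p as v \<Longrightarrow> computes xs p as w \<Longrightarrow> v = w"
proof (induction arbitrary: w rule: computes.induct)
  case (Comp as qs rs p v)
  from Comp.prems obtain rs' where rs': "list_all2 (\<lambda>q r. computes xs q as r) qs rs'"
    and w: "computes xs p rs' w"
    by (rule computes_elims(5))
  have "rs = rs'"
    using Comp.IH(1) rs' by (simp add: list_all2_conv_all_nth list_eq_iff_nth_eq)
  with Comp.IH(2) w show ?case by blast
next
  case (PrimRec_Suc p q a as r v)
  from PrimRec_Suc.prems obtain r' where "computes xs (PrimRec p q) (a # as) r'"
    "computes xs q (a # r' # as) w"
    by (rule computes_elims(7))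
  with PrimRec_Suc.IH show ?case by blast
next
  case (Mu p a as)
  from Mu.prems have w: "computes xs p (w # as) 0"
    "\<And>c. c < w \<Longrightarrow> \<exists>u. computes xs p (c # as) (Suc u)"
    by (rule computes_elims(8), blast)+
  show ?case
  proof (rule linorder_cases[of a w])
    assume "a < w"
    from w(2)[OF this] Mu.IH(1) show ?thesis by blast
  next
    assume "w < a"
    from Mu.IH(2)[OF this] w(1) show ?thesis by blast
  qed
next
  case Zero from Zero.prems show ?case by (rule computes_elims(1)) simp
next
  case Succ from Succ.prems show ?case by (rule computes_elims(2)) simp
next
  case Proj from Proj.prems show ?case by (rule computes_elims(3)) simp
next
  case Query from Query.prems show ?case by (rule computes_elims(4)) simp
next
  case PrimRec_0 from PrimRec_0.prems show ?case
    by (rule computes_elims(6)) (rule PrimRec_0.IH)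
qed

text \<open>
  Computable partial functionals \<open>(2\<^sup>\<omega>)\<^sup>n \<rightarrow> (2\<^sup>\<omega>)\<^sup>n\<close> and \<open>(2\<^sup>\<omega>)\<^sup>n \<times> {0,1} \<rightarrow> {0,1}\<close>.  As usual for
  partial functionals, nothing is required of the program outside their domain.
\<close>

definition computable_map :: "nat \<Rightarrow> (cantor list \<Rightarrow> cantor list option) \<Rightarrow> bool" where
  "computable_map n \<Phi> \<longleftrightarrow> (\<exists>p. \<forall>xs ys. length xs = n \<longrightarrow> \<Phi> xs = Some ys \<longrightarrow>
     length ys = n \<and> (\<forall>i<n. \<forall>k. computes xs p [i, k] (of_bool ((ys ! i) k))))"

definition computable_bit :: "nat \<Rightarrow> (cantor list \<Rightarrow> bool \<Rightarrow> bool option) \<Rightarrow> bool" where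
  "computable_bit n \<Psi> \<longleftrightarrow> (\<exists>p. \<forall>xs b c. length xs = n \<longrightarrow> \<Psi> xs b = Some c \<longrightarrow>
     computes xs p [of_bool b] (of_bool c))"


subsection \<open>Reducibilities\<close>

text \<open>Weihrauch reducibility and its strong form, for total functions \<open>f, g : (2\<^sup>\<omega>)\<^sup>n \<rightarrow> {0,1}\<close>.\<close>

definition weihrauch_le :: "nat \<Rightarrow> (cantor list \<Rightarrow> bool) \<Rightarrow> (cantor list \<Rightarrow> bool) \<Rightarrow> bool" where
  "weihrauch_le n f g \<longleftrightarrow> (\<exists>\<Phi> \<Psi>. computable_map n \<Phi> \<and> computable_bit n \<Psi> \<and>
     (\<forall>xs. length xs = n \<longrightarrow> (\<exists>ys. \<Phi> xs = Some ys \<and> \<Psi> xs (g ys) = Some (f xs))))"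

definition strong_weihrauch_le :: "nat \<Rightarrow> (cantor list \<Rightarrow> bool) \<Rightarrow> (cantor list \<Rightarrow> bool) \<Rightarrow> bool" where
  "strong_weihrauch_le n f g \<longleftrightarrow> (\<exists>\<Phi> \<Psi>. computable_map n \<Phi> \<and> computable_bit 0 (\<lambda>_. \<Psi>) \<and>
     (\<forall>xs. length xs = n \<longrightarrow> (\<exists>ys. \<Phi> xs = Some ys \<and> \<Psi> (g ys) = Some (f xs))))"

definition computable :: "(nat \<Rightarrow> nat) \<Rightarrow> bool" where
  "computable f \<longleftrightarrow> (\<exists>p. \<forall>a. computes [] p [a] (f a))"

definition one_reducible :: "nat set \<Rightarrow> nat set \<Rightarrow> bool" where
  "one_reducible A B \<longleftrightarrow> (\<exists>f. computable f \<and> inj f \<and> (\<forall>a. a \<in> A \<longleftrightarrow> f a \<in> B))"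

definition one_equiv :: "nat set \<Rightarrow> nat set \<Rightarrow> bool" where
  "one_equiv A B \<longleftrightarrow> one_reducible A B \<and> one_reducible B A"

end

theory Submission
  imports Defs "HOL-Library.Countable_Set"
begin

text \<open>
  Take \<open>\<beta>\<^sub>j = \<gamma> \<circ> \<rho>\<^sub>j\<close>, where \<open>\<rho>\<^sub>j\<close> is the computable involution of \<open>\<omega>\<close> that reverses each block of
  length \<open>j + 2\<close>, and \<open>\<gamma>\<close> is generic for countably many open sets; all \<open>\<beta>\<^sub>j\<close> are then one-equivalent.
  Restrict a reduction of \<open>s\<^sup>G\<close> to \<open>s\<^sup>F\<close> to the tuples \<open>(\<delta> \<circ> \<rho>\<^sub>0, \<dots>, \<delta> \<circ> \<rho>\<^bsub>n-1\<^esub>)\<close> with \<open>\<delta>\<close> close to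
  \<open>\<gamma>\<close>.  By genericity, the \<open>i\<close>-th component of the inner functional is there either the projection to
  the \<open>i\<close>-th coordinate or has constant cut value, and the outer functional depends on its bit only.
  So \<open>G\<close> is a function of a restriction of \<open>F\<close> on all patterns of cuts that occur arbitrarily
  close to \<open>\<gamma>\<close>.  If all \<open>i + 2\<close> with \<open>i < n\<close> divide \<open>\<ell>\<close>, then \<open>\<rho>\<^sub>i\<close> preserves \<open>{0..<\<ell>}\<close> and maps \<open>\<ell>\<close> to
  \<open>\<ell> + 1 + i\<close>, so inverting \<open>\<gamma>\<close> from \<open>\<ell>\<close> on gives \<open>n\<close> independent cut values, read off from \<open>\<gamma>\<close> at
  \<open>\<ell> + 1, \<dots>, \<ell> + n\<close>; hence every pattern occurs.
\<close>

text \<open>There is one genericity requirement per program and finite parameter, so countability of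
  programs keeps the requirements countable.\<close>

instance prog :: countable
  by countable_datatype


subsection \<open>Programs\<close>

text \<open>Without input points no \<open>Query\<close> can halt, so the derivation never looks at
  the input and transfers to any \<open>xs\<close>. This turns the outer functional of a strong
  reduction into one that ignores its input.\<close>

lemma computes_mono:
  "computes [] p as v \<Longrightarrow> computes xs p as v"
proof (induction rule: computes.induct)
  case (Comp as qs rs p v)
  from Comp.IH(1) have "list_all2 (\<lambda>q r. computes xs q as r) qs rs"
    by (rule list_all2_mono) blast
  then show ?case using Comp.IH(2) by (rule computes.Comp)
next
  case (Mu p a as)
  show ?case
  proof (rule computes.Mu)
    show "computes xs p (a # as) 0" by (rule Mu.IH(1))
    show "\<exists>w. computes xs p (c # as) (Suc w)" if "c < a" for c
      using Mu.IH(2)[OF that] by blast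
  qed
qed (auto intro: computes.intros)

definition close :: "nat \<Rightarrow> cantor list \<Rightarrow> cantor list \<Rightarrow> bool" where
  "close m xs ys \<longleftrightarrow> length ys = length xs \<and> (\<forall>i<length xs. \<forall>k<m. (ys ! i) k = (xs ! i) k)"

lemma close_max: "close (max l m) xs ys \<longleftrightarrow> close l xs ys \<and> close m xs ys"
  by (auto simp: close_def less_max_iff_disj)

lemma close_uniform:
  assumes "\<And>j. j < (n::nat) \<Longrightarrow> \<exists>m. \<forall>ys. close m xs ys \<longrightarrow> P j ys"
  shows "\<exists>m. \<forall>ys. close m xs ys \<longrightarrow> (\<forall>j<n. P j ys)"
  using assms
proof (induction n)
  case (Suc n)
  then obtain l m where "\<forall>ys. close l xs ys \<longrightarrow> (\<forall>j<n. P j ys)" "\<forall>ys. close m xs ys \<longrightarrow> P n ys"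
    by (metis lessI less_SucI)
  then show ?case
    by (intro exI[of _ "max l m"]) (auto simp: less_Suc_eq close_max)
qed simp

text \<open>The use principle: a halting computation reads finitely many digits. The radius is built
  along the derivation, as the maximum of the radii of the subcomputations.\<close>

lemma computes_use:
  assumes "computes xs p as v"
  shows "\<exists>m. \<forall>ys. close m xs ys \<longrightarrow> computes ys p as v"
  using assms
proof (induction rule: computes.induct)
  case (Query i a)
  have "computes ys (Query i) [a] (of_bool ((xs ! i) a))" if "close (Suc a) xs ys" for ys
    using that Query computes.Query[of i ys a] by (simp add: close_def)
  then show ?case by blast
next
  case (Comp as qs rs p v)
  have len: "length qs = length rs"
    using Comp.IH(1) by (rule list_all2_lengthD)
  have "\<exists>m. \<forall>ys. close m xs ys \<longrightarrow> computes ys (qs ! j) as (rs ! j)" if "j < length qs" for j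
    using list_all2_nthD[OF Comp.IH(1) that] by blast
  from close_uniform[where n = "length qs" and P = "\<lambda>j ys. computes ys (qs ! j) as (rs ! j)", OF this] obtain l where
    l: "\<forall>ys. close l xs ys \<longrightarrow> (\<forall>j<length qs. computes ys (qs ! j) as (rs ! j))"
    by blast
  obtain m where m: "\<forall>ys. close m xs ys \<longrightarrow> computes ys p rs v"
    using Comp.IH(2) by blast
  have "computes ys (Comp p qs) as v" if "close (max l m) xs ys" for ys
  proof (rule computes.Comp)
    show "list_all2 (\<lambda>q r. computes ys q as r) qs rs"
      using that l len by (simp add: close_max list_all2_conv_all_nth)
    show "computes ys p rs v"
      using that m by (simp add: close_max)
  qed
  then show ?case by blast
next
  case (PrimRec_0 p as v q)
  then show ?case by (meson computes.PrimRec_0)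
next
  case (PrimRec_Suc p q a as r v)
  then obtain l m where
    "\<forall>ys. close l xs ys \<longrightarrow> computes ys (PrimRec p q) (a # as) r"
    "\<forall>ys. close m xs ys \<longrightarrow> computes ys q (a # r # as) v"
    by blast
  then show ?case
    by (intro exI[of _ "max l m"]) (auto simp: close_max intro: computes.PrimRec_Suc)
next
  case (Mu p a as)
  \<comment> \<open>Only the finitely many searches below \<open>a\<close> matter, and of their
    values only that they are successors.\<close>
  have "\<exists>m. \<forall>ys. close m xs ys \<longrightarrow> (\<exists>w. computes ys p (c # as) (Suc w))" if "c < a" for c
    using Mu.IH(2)[OF that] by blast
  from close_uniform[where n = a and P = "\<lambda>c ys. \<exists>w. computes ys p (c # as) (Suc w)", OF this] obtain l where
    l: "\<forall>ys. close l xs ys \<longrightarrow> (\<forall>c<a. \<exists>w. computes ys p (c # as) (Suc w))"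
    by blast
  obtain m where m: "\<forall>ys. close m xs ys \<longrightarrow> computes ys p (a # as) 0"
    using Mu.IH(1) by blast
  have "computes ys (Mu p) as a" if "close (max l m) xs ys" for ys
    using that l m
    by (intro computes.Mu) (simp_all add: close_max)
  then show ?case by blast
qed (auto intro: computes.intros)

section \<open>Programs for elementary arithmetic and finite case distinction\<close>

lemma computes_Comp1:
  "computes xs q as r \<Longrightarrow> computes xs p [r] v \<Longrightarrow> computes xs (Comp p [q]) as v"
  by (auto intro: computes.Comp[where rs = "[r]"])

lemma computes_Comp2:
  "computes xs q as r \<Longrightarrow> computes xs q' as r' \<Longrightarrow> computes xs p [r, r'] v \<Longrightarrow>
    computes xs (Comp p [q, q']) as v"
  by (auto intro: computes.Comp[where rs = "[r, r']"])

lemma computes_Proj0: "computes xs (Proj 0) (a # as) a"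
  using computes.Proj[of 0 "a # as"] by simp

lemma computes_Proj1: "computes xs (Proj 1) (a # b # as) b"
  using computes.Proj[of 1 "a # b # as"] by simp

lemma computes_Proj2: "computes xs (Proj 2) (a # b # c # as) c"
  using computes.Proj[of 2 "a # b # c # as"] by simp

fun const_prog :: "nat \<Rightarrow> prog" where
  "const_prog 0 = Zero"
| "const_prog (Suc c) = Comp Succ [const_prog c]"

lemma computes_const: "computes xs (const_prog c) as c"
  by (induction c) (auto intro: computes.intros computes_Comp1)

definition add_prog :: prog where
  "add_prog = PrimRec (Proj 0) (Comp Succ [Proj 1])"

lemma computes_add: "computes xs add_prog [a, b] (a + b)"
  unfolding add_prog_def
proof (induction a)
  case (Suc a)
  show ?case
    unfolding add_Suc by (rule computes.PrimRec_Suc[OF Suc computes_Comp1[OF computes_Proj1 computes.Succ]])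
qed (auto intro: computes.PrimRec_0 computes_Proj0)

definition pred_prog :: prog where
  "pred_prog = PrimRec Zero (Proj 0)"

lemma computes_pred: "computes xs pred_prog [a] (a - 1)"
proof (induction a)
  case (Suc a)
  then show ?case unfolding pred_prog_def
    by (auto intro: computes.PrimRec_Suc computes_Proj0)
qed (auto simp: pred_prog_def intro: computes.PrimRec_0 computes.Zero)

definition sub_prog :: prog where
  "sub_prog = PrimRec (Proj 0) (Comp pred_prog [Proj 1])"

lemma computes_sub: "computes xs sub_prog [a, b] (b - a)"
  unfolding sub_prog_def
proof (induction a)
  case (Suc a)
  show ?case
    using computes.PrimRec_Suc[OF Suc computes_Comp1[OF computes_Proj1 computes_pred]] by simp
qed (auto intro: computes.PrimRec_0 computes_Proj0)

text \<open>Primitive recursion on the index \<open>i\<close> acts as a case distinction: the base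
  case runs the program for index 0, and the step drops the recursive value and runs a program for
  the shifted family, which the induction hypothesis supplies.\<close>

lemma computes_finite_dispatch:
  assumes "\<And>i. i < n \<Longrightarrow> \<exists>p. \<forall>xs. length xs = N \<longrightarrow> (\<forall>k. computes xs p [k] (h i xs k))"
  shows "\<exists>p. \<forall>xs. length xs = N \<longrightarrow> (\<forall>i<n. \<forall>k. computes xs p [i, k] (h i xs k))"
  using assms
proof (induction n arbitrary: h)
  case (Suc n)
  obtain p where p: "\<And>xs k. length xs = N \<Longrightarrow> computes xs p [k] (h 0 xs k)"
    using Suc.prems[of 0] by auto
  have "\<exists>q. \<forall>xs. length xs = N \<longrightarrow> (\<forall>i<n. \<forall>k. computes xs q [i, k] (h (Suc i) xs k))"
    by (rule Suc.IH) (simp add: Suc.prems)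
  then obtain q where q: "\<And>xs i k. length xs = N \<Longrightarrow> i < n \<Longrightarrow> computes xs q [i, k] (h (Suc i) xs k)"
    by blast
  let ?p = "PrimRec p (Comp q [Proj 0, Proj 2])"
  have "computes xs ?p [i, k] (h i xs k)" if xs: "length xs = N" and "i < Suc n" for xs i k
    using \<open>i < Suc n\<close>
  proof (induction i)
    case 0
    then show ?case by (simp add: computes.PrimRec_0 p xs)
  next
    case (Suc i)
    then have "computes xs ?p [i, k] (h i xs k)" by simp
    moreover have "computes xs (Comp q [Proj 0, Proj 2]) [i, h i xs k, k] (h (Suc i) xs k)"
      using Suc.prems by (intro computes_Comp2[OF computes_Proj0 computes_Proj2] q xs) simp
    ultimately show ?case by (rule computes.PrimRec_Suc)
  qed
  then show ?case by blast
qed simp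


subsection \<open>Reversal of blocks\<close>

definition block_rev :: "nat \<Rightarrow> nat \<Rightarrow> nat" where
  "block_rev j a = (j + 2) * (a div (j + 2)) + (j + 1 - a mod (j + 2))"

lemma block_rev_div: "block_rev j a div (j + 2) = a div (j + 2)"
  unfolding block_rev_def by (subst div_mult_self4) auto

lemma block_rev_mod: "block_rev j a mod (j + 2) = j + 1 - a mod (j + 2)"
  unfolding block_rev_def by (subst mod_mult_self4) auto

lemma block_rev_involution [simp]: "block_rev j (block_rev j a) = a"
proof -
  have "a mod (j + 2) < j + 2" by simp
  then have "j + 1 - (j + 1 - a mod (j + 2)) = a mod (j + 2)" by linarith
  then show ?thesis
    unfolding block_rev_def[of j "block_rev j a"] block_rev_div block_rev_mod
    by (simp only: mult_div_mod_eq)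
qed

lemma inj_block_rev: "inj (block_rev j)"
  by (metis block_rev_involution injI)

text \<open>Here \<open>l\<close> is a boundary between blocks, so no block straddles it.\<close>

lemma block_rev_less:
  assumes "(j + 2) dvd l" and "a < l"
  shows "block_rev j a < l"
proof -
  from assms(1) obtain t where "l = t * (j + 2)" by (metis dvdE mult.commute)
  with assms(2) show ?thesis
    using block_rev_div[of j a] by (metis add_2_eq_Suc' div_less_iff_less_mult zero_less_Suc)
qed

text \<open>The first position of a block goes to its last one. These positions differ for different
  \<open>j\<close>, which is what makes the cut values independent.\<close>

lemma block_rev_dvd: "(j + 2) dvd l \<Longrightarrow> block_rev j l = l + 1 + j"
  by (simp only: block_rev_def dvd_mult_div_cancel dvd_eq_mod_eq_0[symmetric] dvd_imp_mod_0)

text \<open>A cyclic counter running from \<open>c\<close> down to 0: it yields the mirrored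
  remainder modulo \<open>c + 1\<close> by a direct recursion instead of a division.\<close>

primrec countdown :: "nat \<Rightarrow> nat \<Rightarrow> nat" where
  "countdown c 0 = c"
| "countdown c (Suc a) = (case countdown c a of 0 \<Rightarrow> c | Suc r \<Rightarrow> r)"

lemma countdown_eq: "countdown c a = c - a mod Suc c"
proof (induction a)
  case (Suc a)
  define r where "r = a mod Suc c"
  then have "r \<le> c" by (simp add: less_Suc_eq_le[symmetric] del: less_Suc_eq_le)
  with Suc show ?case by (auto simp: mod_Suc simp flip: r_def split: nat.split)
qed simp

lemma countdown_computable: "\<exists>p. \<forall>a. computes xs p [a] (countdown c a)"
proof -
  \<comment> \<open>A case distinction, written as a recursion whose step returns the predecessor
    and ignores the recursive value.\<close>
  let ?r = "PrimRec (const_prog c) (Proj 0)"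
  have r: "computes xs ?r [b] (case b of 0 \<Rightarrow> c | Suc r \<Rightarrow> r)" for b
    by (induction b) (auto intro: computes.PrimRec_0 computes_const computes.PrimRec_Suc computes_Proj0)
  have "computes xs (PrimRec (const_prog c) (Comp ?r [Proj 1])) [a] (countdown c a)" for a
  proof (induction a)
    case (Suc a)
    show ?case
      unfolding countdown.simps
      by (rule computes.PrimRec_Suc[OF Suc computes_Comp1[OF computes_Proj1 r]])
  qed (auto intro: computes.PrimRec_0 computes_const)
  then show ?thesis by blast
qed

text \<open>If \<open>r\<close> is the remainder of \<open>a\<close> and
  \<open>d = j + 1 - r\<close> its mirror image, the value is \<open>a - r + d\<close>, that is,
  \<open>a + 2 * d - (j + 1)\<close>. The subtraction does not truncate, since \<open>a + d\<close>
  is at least \<open>r + d = j + 1\<close>.\<close>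

lemma block_rev_eq: "block_rev j a = a + (countdown (j + 1) a + countdown (j + 1) a) - (j + 1)"
proof -
  have "a mod (j + 2) < j + 2" by simp
  moreover have "a = (j + 2) * (a div (j + 2)) + a mod (j + 2)"
    by (simp only: mult_div_mod_eq)
  moreover have "countdown (j + 1) a = j + 1 - a mod (j + 2)"
    by (simp add: countdown_eq)
  ultimately show ?thesis unfolding block_rev_def by linarith
qed

lemma computable_block_rev: "computable (block_rev j)"
proof -
  obtain p where p: "\<And>a. computes [] p [a] (countdown (j + 1) a)"
    using countdown_computable by blast
  let ?q = "Comp sub_prog [const_prog (j + 1), Comp add_prog [Proj 0, Comp add_prog [p, p]]]"
  have "computes [] ?q [a] (block_rev j a)" for a
    unfolding block_rev_eq
    by (intro computes_Comp2[OF computes_const _ computes_sub] computes_Comp2[OF computes_Proj0 _ computes_add]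
      computes_Comp2[OF p p computes_add])
  then show ?thesis unfolding computable_def by blast
qed

lemma computable_comp:
  assumes "computable f" "computable g"
  shows "computable (f \<circ> g)"
proof -
  obtain p q where "\<And>a. computes [] p [a] (f a)" "\<And>a. computes [] q [a] (g a)"
    using assms unfolding computable_def by blast
  then have "computes [] (Comp p [q]) [a] ((f \<circ> g) a)" for a
    by (auto intro: computes_Comp1)
  then show ?thesis unfolding computable_def by blast
qed

text \<open>As \<open>block_rev k\<close> is an involution,
  \<open>\<gamma> \<circ> block_rev j\<close> is \<open>\<gamma> \<circ> block_rev k\<close>
  composed with the computable permutation \<open>block_rev k \<circ> block_rev j\<close>.\<close>

lemma one_equiv_block_rev:
  "one_equiv {a. (\<gamma> \<circ> block_rev j) a} {a. (\<gamma> \<circ> block_rev k) a}"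
proof -
  have "one_reducible {a. (\<gamma> \<circ> block_rev j) a} {a. (\<gamma> \<circ> block_rev k) a}" for j k
    unfolding one_reducible_def
    by (intro exI[of _ "block_rev k \<circ> block_rev j"] conjI computable_comp computable_block_rev
      inj_compose inj_block_rev) simp
  then show ?thesis unfolding one_equiv_def by blast
qed


subsection \<open>Generic points\<close>

definition agree :: "nat \<Rightarrow> cantor \<Rightarrow> cantor \<Rightarrow> bool" where
  "agree m x y \<longleftrightarrow> (\<forall>k<m. x k = y k)"

lemma agree_refl [simp]: "agree m x x"
  by (simp add: agree_def)

lemma agree_mono: "agree m x y \<Longrightarrow> l \<le> m \<Longrightarrow> agree l x y"
  by (simp add: agree_def)

lemma agree_max: "agree (max l m) x y \<longleftrightarrow> agree l x y \<and> agree m x y"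
  by (auto simp: agree_def less_max_iff_disj)

lemma agree_trans: "agree m x y \<Longrightarrow> agree m y z \<Longrightarrow> agree m x z"
  by (simp add: agree_def)

definition cantor_open :: "cantor set \<Rightarrow> bool" where
  "cantor_open U \<longleftrightarrow> (\<forall>x\<in>U. \<exists>m. \<forall>y. agree m x y \<longrightarrow> y \<in> U)"

text \<open>For open \<open>U\<close> this says that \<open>x\<close> is not on the boundary of
  \<open>U\<close>.\<close>

definition generic_for :: "cantor set \<Rightarrow> cantor \<Rightarrow> bool" where
  "generic_for U x \<longleftrightarrow> x \<in> U \<or> (\<exists>m. \<forall>y. agree m x y \<longrightarrow> y \<notin> U)"

text \<open>The Baire category argument: extend a finite prefix again and again so that stage
  \<open>k\<close> decides the \<open>k\<close>-th open set.\<close>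

lemma generic_exists:
  assumes "countable \<U>" and "\<And>U. U \<in> \<U> \<Longrightarrow> cantor_open U"
  shows "\<exists>x. \<forall>U\<in>\<U>. generic_for U x"
proof (cases "\<U> = {}")
  case False
  then obtain V :: "nat \<Rightarrow> cantor set" where V: "range V = \<U>"
    using assms(1) by (metis range_from_nat_into)
  \<comment> \<open>The pair of \<open>x\<close> and \<open>m\<close> stands for the prefix of
    \<open>x\<close> of length \<open>m\<close>; it is good if all its extensions agree about
    membership in \<open>V k\<close>.\<close>
  define good where "good k x m \<longleftrightarrow>
    (\<forall>y. agree m x y \<longrightarrow> y \<in> V k) \<or> (\<forall>y. agree m x y \<longrightarrow> y \<notin> V k)" for k x m
  have step: "\<exists>x' m'. agree m x x' \<and> m < m' \<and> good k x' m'" for k x m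
  proof (cases "\<exists>y. agree m x y \<and> y \<in> V k")
    case True
    then obtain y where y: "agree m x y" "y \<in> V k" by blast
    then obtain l where "\<forall>z. agree l y z \<longrightarrow> z \<in> V k"
      using assms(2) V unfolding cantor_open_def by blast
    then have "good k y (max l (Suc m))"
      unfolding good_def by (simp add: agree_max)
    moreover have "m < max l (Suc m)" by simp
    ultimately show ?thesis using y(1) by blast
  next
    case False
    then have "good k x (Suc m)"
      unfolding good_def using agree_mono[of "Suc m" x _ m] by auto
    then have "agree m x x \<and> m < Suc m \<and> good k x (Suc m)" by simp
    then show ?thesis by blast
  qed
  have "\<exists>f. \<forall>k. good k (fst (f k)) (snd (f k)) \<and>
      (agree (snd (f k)) (fst (f k)) (fst (f (Suc k))) \<and> snd (f k) < snd (f (Suc k)))"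
  proof (rule dependent_nat_choice)
    show "\<exists>s. good 0 (fst s) (snd s)" using step[of 0 undefined 0] by auto
    show "\<exists>s'. good (Suc k) (fst s') (snd s') \<and> (agree (snd s) (fst s) (fst s') \<and> snd s < snd s')" for s k
      using step[of "snd s" "fst s" "Suc k"] by auto
  qed
  then obtain f where f: "\<And>k. good k (fst (f k)) (snd (f k))"
    "\<And>k. agree (snd (f k)) (fst (f k)) (fst (f (Suc k)))" "\<And>k. snd (f k) < snd (f (Suc k))"
    by blast
  \<comment> \<open>The prefix at stage \<open>Suc a\<close> is longer than \<open>a\<close>,
    because lengths grow strictly, so digit \<open>a\<close> is settled there.\<close>
  define x where "x a = fst (f (Suc a)) a" for a
  have mono: "snd (f k) \<le> snd (f (k + d))" for k d
    by (induction d) (auto intro: le_trans less_imp_le[OF f(3)])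
  have chain: "agree (snd (f k)) (fst (f k)) (fst (f (k + d)))" for k d
  proof (induction d)
    case (Suc d)
    have "agree (snd (f k)) (fst (f (k + d))) (fst (f (k + Suc d)))"
      using f(2)[of "k + d"] mono agree_mono by simp
    with Suc show ?case by (rule agree_trans)
  qed simp
  have large: "k \<le> snd (f k)" for k
  proof (induction k)
    case (Suc k)
    then show ?case using f(3)[of k] by linarith
  qed simp
  have x: "agree (snd (f k)) (fst (f k)) x" for k
    unfolding agree_def x_def
  proof (intro allI impI)
    fix a assume a: "a < snd (f k)"
    show "fst (f k) a = fst (f (Suc a)) a"
    proof (cases "k \<le> Suc a")
      case True
      then show ?thesis using chain[of k "Suc a - k"] a by (simp add: agree_def)
    next
      case False
      have "a < snd (f (Suc a))" using large[of "Suc a"] by simp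
      then show ?thesis using chain[of "Suc a" "k - Suc a"] False by (simp add: agree_def)
    qed
  qed
  have "generic_for (V k) x" for k
  proof -
    have "agree (snd (f k)) (fst (f k)) y" if "agree (snd (f k)) x y" for y
      using x that by (rule agree_trans)
    then show ?thesis using f(1)[of k] x unfolding good_def generic_for_def by blast
  qed
  then show ?thesis using V by blast
qed simp


subsection \<open>Cuts\<close>

lemma less_fun_first_diff:
  fixes x y :: cantor
  assumes "agree k x y" "x k \<noteq> y k"
  shows "less_fun x y \<longleftrightarrow> y k"
proof
  assume "less_fun x y"
  then obtain l where l: "x l < y l" "\<And>k'. k' < l \<Longrightarrow> x k' = y k'"
    by (auto simp: less_fun_def)
  have "\<not> l < k" using l(1) assms(1) by (auto simp: agree_def)
  moreover have "\<not> k < l" using l(2) assms(2) by auto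
  ultimately have "l = k" by simp
  with l show "y k" by simp
next
  assume "y k"
  with assms show "less_fun x y"
    unfolding less_fun_def agree_def by (intro exI[of _ k]) simp
qed

lemma cut_first_diff: "agree k x \<alpha> \<Longrightarrow> x k \<noteq> \<alpha> k \<Longrightarrow> cut \<alpha> x \<longleftrightarrow> \<not> \<alpha> k"
  by (simp add: cut_def less_fun_first_diff)

text \<open>The first digit where \<open>y\<close> differs from \<open>\<alpha>\<close> already
  decides the comparison, so \<open>cut \<alpha>\<close> can be discontinuous only at
  \<open>\<alpha>\<close>.\<close>

lemma cut_locally_constant:
  assumes "y \<noteq> \<alpha>"
  shows "\<exists>m. \<forall>z. agree m y z \<longrightarrow> cut \<alpha> z = cut \<alpha> y"
proof -
  from assms have "\<exists>k. y k \<noteq> \<alpha> k" by (simp add: fun_eq_iff)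
  then obtain k where k: "y k \<noteq> \<alpha> k" "agree k y \<alpha>"
    unfolding agree_def by (subst (asm) exists_least_iff) blast
  have "cut \<alpha> z = cut \<alpha> y" if "agree (Suc k) y z" for z
  proof -
    from that k have "z k \<noteq> \<alpha> k" "agree k z \<alpha>" by (simp_all add: agree_def)
    then show ?thesis using k cut_first_diff by blast
  qed
  then show ?thesis by blast
qed

text \<open>The sequence of ones is maximal, and the sequence of zeros lies strictly below every
  \<open>\<alpha>\<close> containing a 1. Thus fixing an entry of the truth-table input can be
  simulated by a computable constant input.\<close>

lemma cut_const:
  assumes "proper \<alpha>"
  shows "cut \<alpha> (\<lambda>_. b) = b"
proof (cases b)
  case True
  then show ?thesis by (auto simp: cut_def less_fun_def)
next
  case False
  from assms have "\<exists>k. \<alpha> k" unfolding proper_def using not_finite_existsD by blast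
  then obtain k where "\<alpha> k" "agree k (\<lambda>_. False) \<alpha>"
    unfolding agree_def by (subst (asm) exists_least_iff) auto
  with False show ?thesis using cut_first_diff[of k "\<lambda>_. b" \<alpha>] by simp
qed


subsection \<open>Substituting constants gives a strong reduction\<close>

lemma foldr_set_coord_cut:
  assumes "\<And>i. i < length \<beta>s \<Longrightarrow> proper (\<beta>s ! i)" "length xs = length \<beta>s"
  shows "map2 cut \<beta>s (foldr (\<lambda>(i, b) zs. zs[i := (\<lambda>_. b)]) ps xs) =
    foldr (\<lambda>(i, b). set_coord i b) ps (map2 cut \<beta>s xs)
    \<and> length (foldr (\<lambda>(i, b) zs. zs[i := (\<lambda>_. b)]) ps xs) = length \<beta>s"
proof (induction ps)
  case (Cons a ps)
  obtain i b where a: "a = (i, b)" by force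
  define zs where "zs = foldr (\<lambda>(i, b) zs. zs[i := (\<lambda>_. b)]) ps xs"
  have zs: "length zs = length \<beta>s" using Cons by (simp add: zs_def)
  have "cut (\<beta>s ! j) (zs[i := (\<lambda>_. b)] ! j) = (map2 cut \<beta>s zs)[i := b] ! j" if "j < length \<beta>s" for j
    by (cases "i = j") (simp_all add: that zs cut_const assms(1))
  then have "map2 cut \<beta>s (zs[i := (\<lambda>_. b)]) = (map2 cut \<beta>s zs)[i := b]"
    by (intro nth_equalityI) (simp_all add: zs)
  with Cons show ?case by (simp add: a set_coord_def flip: zs_def)
qed (simp add: assms)

text \<open>Which alternative holds is independent of \<open>xs\<close>, so each output coordinate
  has a fixed program: a query or a constant.\<close>

lemma foldr_const_coord:
  assumes "i < n"
  shows "(\<forall>xs. length xs = n \<longrightarrow> foldr (\<lambda>(i, b) zs. zs[i := (\<lambda>_. b)]) ps xs ! i = xs ! i) \<or>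
    (\<exists>b. \<forall>xs :: cantor list. length xs = n \<longrightarrow> foldr (\<lambda>(i, b) zs. zs[i := (\<lambda>_. b)]) ps xs ! i = (\<lambda>_. b))"
proof (induction ps)
  case (Cons a ps)
  obtain j b where a: "a = (j, b)" by force
  have len: "length (foldr (\<lambda>(i, b) zs. zs[i := (\<lambda>_. b)]) ps xs) = length xs" for xs :: "cantor list"
    by (induction ps) auto
  show ?case
  proof (cases "i = j")
    case True
    with assms show ?thesis by (intro disjI2 exI[of _ b]) (simp add: a len)
  next
    case False
    with Cons show ?thesis by (simp add: a)
  qed
qed simp

lemma computable_map_foldr_const:
  "computable_map n (\<lambda>xs. Some (foldr (\<lambda>(i, b) zs. zs[i := (\<lambda>_. b)]) ps xs))"
proof -
  let ?\<Phi> = "foldr (\<lambda>(i, b) zs. zs[i := (\<lambda>_. b)]) ps :: cantor list \<Rightarrow> cantor list"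
  have len: "length (?\<Phi> xs) = length xs" for xs
    by (induction ps) auto
  have "\<exists>p. \<forall>xs. length xs = n \<longrightarrow> (\<forall>k. computes xs p [k] (of_bool ((?\<Phi> xs ! i) k)))" if "i < n" for i
    using foldr_const_coord[OF that, of ps]
  proof (elim disjE exE)
    assume "\<forall>xs. length xs = n \<longrightarrow> ?\<Phi> xs ! i = xs ! i"
    with that show ?thesis by (intro exI[of _ "Query i"]) (simp add: computes.Query)
  next
    fix b
    assume "\<forall>xs. length xs = n \<longrightarrow> ?\<Phi> xs ! i = (\<lambda>_. b)"
    then show ?thesis by (intro exI[of _ "const_prog (of_bool b)"]) (simp add: computes_const)
  qed
  from computes_finite_dispatch[where h = "\<lambda>i xs k. of_bool ((?\<Phi> xs ! i) k)", OF this] show ?thesis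
    unfolding computable_map_def by (auto simp: len)
qed

lemma computable_bit_Not: "computable_bit 0 (\<lambda>_ b. Some (\<not> b))"
proof -
  let ?p = "PrimRec (const_prog 1) Zero"
  have *: "computes xs ?p [0] 1" for xs
    by (rule computes.PrimRec_0 computes_const)+
  then have "computes xs ?p [Suc 0] 0" for xs
    by (auto intro: computes.PrimRec_Suc computes.Zero)
  with * have "computes xs ?p [of_bool b] (of_bool (\<not> b))" for xs b
    by (cases b) auto
  then show ?thesis unfolding computable_bit_def by blast
qed

lemma computable_bit_id: "computable_bit 0 (\<lambda>_ b. Some b)"
  unfolding computable_bit_def using computes_Proj0 by auto

text \<open>The inner functional overwrites the coordinates in \<open>ivec\<close> by constant
  sequences; the outer one is the identity or negation and looks at the bit alone.\<close>

lemma tt_fix_imp_strong_weihrauch_le: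
  assumes proper: "\<And>i. i < n \<Longrightarrow> proper (\<beta>s ! i)" and len: "length \<beta>s = n"
    and G: "(\<forall>v. length v = n \<longrightarrow> G v = tt_fix F ivec bvec v) \<or>
      (\<forall>v. length v = n \<longrightarrow> G v = (\<not> tt_fix F ivec bvec v))"
  shows "strong_weihrauch_le n (tt_cut G \<beta>s) (tt_cut F \<beta>s)"
proof -
  let ?\<Phi> = "foldr (\<lambda>(i, b) zs. zs[i := (\<lambda>_. b)]) (zip ivec bvec) :: cantor list \<Rightarrow> cantor list"
  have F: "tt_cut F \<beta>s (?\<Phi> xs) = tt_fix F ivec bvec (map2 cut \<beta>s xs)" if "length xs = n" for xs
    unfolding tt_cut_def tt_fix_def
    using foldr_set_coord_cut[of \<beta>s xs "zip ivec bvec"] proper that len by simp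
  have "\<exists>e. computable_bit 0 (\<lambda>_ b. Some (e b)) \<and> (\<forall>v. length v = n \<longrightarrow> G v = e (tt_fix F ivec bvec v))"
    using G
  proof
    assume "\<forall>v. length v = n \<longrightarrow> G v = tt_fix F ivec bvec v"
    with computable_bit_id show ?thesis by (intro exI[of _ "\<lambda>b. b"] conjI)
  next
    assume "\<forall>v. length v = n \<longrightarrow> G v = (\<not> tt_fix F ivec bvec v)"
    with computable_bit_Not show ?thesis by (intro exI[of _ Not] conjI)
  qed
  then obtain e where e: "computable_bit 0 (\<lambda>_ b. Some (e b))"
    and "\<And>v. length v = n \<Longrightarrow> G v = e (tt_fix F ivec bvec v)"
    by blast
  then have "tt_cut G \<beta>s xs = e (tt_cut F \<beta>s (?\<Phi> xs))" if "length xs = n" for xs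
    unfolding F[OF that] by (simp add: tt_cut_def len that)
  then have "\<exists>ys. Some (?\<Phi> xs) = Some ys \<and> Some (e (tt_cut F \<beta>s ys)) = Some (tt_cut G \<beta>s xs)"
    if "length xs = n" for xs
    using that by (intro exI[of _ "?\<Phi> xs"]) simp
  then show ?thesis
    unfolding strong_weihrauch_le_def
    by (intro exI[of _ "\<lambda>xs. Some (?\<Phi> xs)"] exI[of _ "\<lambda>b. Some (e b)"] conjI
      computable_map_foldr_const e allI impI)
qed

lemma strong_weihrauch_le_imp_weihrauch_le:
  assumes "strong_weihrauch_le n f g"
  shows "weihrauch_le n f g"
proof -
  obtain \<Phi> \<Psi> where 1: "computable_map n \<Phi>" "computable_bit 0 (\<lambda>_. \<Psi>)"
    "\<forall>xs. length xs = n \<longrightarrow> (\<exists>ys. \<Phi> xs = Some ys \<and> \<Psi> (g ys) = Some (f xs))"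
    using assms unfolding strong_weihrauch_le_def by blast
  from 1(2) obtain p where "\<And>b c. \<Psi> b = Some c \<Longrightarrow> computes [] p [of_bool b] (of_bool c)"
    unfolding computable_bit_def by auto
  then have "computable_bit n (\<lambda>_. \<Psi>)"
    unfolding computable_bit_def using computes_mono by blast
  with 1 show ?thesis unfolding weihrauch_le_def by blast
qed


subsection \<open>Reductions near a generic point\<close>

text \<open>The one-parameter family of inputs on which reductions are tested; at
  \<open>\<gamma>\<close> it is also the tuple of cut points.\<close>

definition diag :: "nat \<Rightarrow> cantor \<Rightarrow> cantor list" where
  "diag n \<delta> = map (\<lambda>j. \<delta> \<circ> block_rev j) [0..<n]"

lemma length_diag [simp]: "length (diag n \<delta>) = n"
  by (simp add: diag_def)

lemma nth_diag [simp]: "i < n \<Longrightarrow> diag n \<delta> ! i = \<delta> \<circ> block_rev i"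
  by (simp add: diag_def)

lemma computes_diag_open:
  assumes "computes (diag n \<delta>) p as v"
  shows "\<exists>m. \<forall>\<delta>'. agree m \<delta> \<delta>' \<longrightarrow> computes (diag n \<delta>') p as v"
proof -
  obtain m where m: "\<And>ys. close m (diag n \<delta>) ys \<Longrightarrow> computes ys p as v"
    using computes_use[OF assms] by blast
  \<comment> \<open>Digit \<open>k\<close> of component \<open>i\<close> is digit
    \<open>block_rev i k\<close> of \<open>\<delta>\<close>, so \<open>M\<close> must exceed all
    these positions; the inserted 0 covers the case that there are none.\<close>
  define M where "M = Suc (Max (insert 0 ((\<lambda>(i, k). block_rev i k) ` ({..<n} \<times> {..<m}))))"
  have M: "block_rev i k < M" if "i < n" "k < m" for i k
    unfolding M_def less_Suc_eq_le by (rule Max_ge) (use that in auto)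
  have "computes (diag n \<delta>') p as v" if "agree M \<delta> \<delta>'" for \<delta>'
    using that M by (intro m) (auto simp: agree_def close_def)
  then show ?thesis by blast
qed

text \<open>A finite computation witnesses that output \<open>i\<close> is not the
  \<open>i\<close>-th input coordinate, so this set is open. A generic point outside it has a whole
  neighbourhood outside it.\<close>

definition inner_fails :: "nat \<Rightarrow> prog \<Rightarrow> nat \<Rightarrow> cantor set" where
  "inner_fails n p i = {\<delta>. \<exists>k v. computes (diag n \<delta>) p [i, k] v \<and> v \<noteq> of_bool (\<delta> (block_rev i k))}"

definition halts :: "nat \<Rightarrow> prog \<Rightarrow> nat \<Rightarrow> cantor set" where
  "halts n q b = {\<delta>. \<exists>v. computes (diag n \<delta>) q [b] v}"

text \<open>The factorial is a multiple of \<open>i + 2\<close> for all \<open>i < n\<close>. The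
  negation is there because a cut value is the complement of the cut point's digit at the first
  difference.\<close>

definition pattern_after :: "nat \<Rightarrow> bool list \<Rightarrow> nat \<Rightarrow> cantor set" where
  "pattern_after n v N = {\<delta>. \<exists>l\<ge>N. fact (n + 1) dvd l \<and> (\<forall>i<n. \<delta> (l + 1 + i) = (\<not> v ! i))}"

lemma open_inner_fails: "cantor_open (inner_fails n p i)"
  unfolding cantor_open_def
proof
  fix \<delta> assume "\<delta> \<in> inner_fails n p i"
  then obtain k v where v: "computes (diag n \<delta>) p [i, k] v" "v \<noteq> of_bool (\<delta> (block_rev i k))"
    by (auto simp: inner_fails_def)
  obtain m where m: "\<And>\<delta>'. agree m \<delta> \<delta>' \<Longrightarrow> computes (diag n \<delta>') p [i, k] v"
    using computes_diag_open[OF v(1)] by blast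
  have "\<delta>' \<in> inner_fails n p i" if "agree (max m (Suc (block_rev i k))) \<delta> \<delta>'" for \<delta>'
  proof -
    have "agree m \<delta> \<delta>'" "\<delta> (block_rev i k) = \<delta>' (block_rev i k)"
      using that by (auto simp: agree_def)
    with m v(2) have "computes (diag n \<delta>') p [i, k] v \<and> v \<noteq> of_bool (\<delta>' (block_rev i k))"
      by (simp only: simp_thms)
    then show ?thesis unfolding inner_fails_def by blast
  qed
  then show "\<exists>m. \<forall>\<delta>'. agree m \<delta> \<delta>' \<longrightarrow> \<delta>' \<in> inner_fails n p i" by blast
qed

lemma open_halts: "cantor_open (halts n q b)"
  unfolding cantor_open_def halts_def using computes_diag_open by blast

lemma open_pattern_after: "cantor_open (pattern_after n v N)"
  unfolding cantor_open_def
proof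
  fix \<delta> assume "\<delta> \<in> pattern_after n v N"
  then obtain l where l: "l \<ge> N" "fact (n + 1) dvd l" "\<forall>i<n. \<delta> (l + 1 + i) = (\<not> v ! i)"
    by (auto simp: pattern_after_def)
  then have "\<delta>' \<in> pattern_after n v N" if "agree (l + 1 + n) \<delta> \<delta>'" for \<delta>'
    using that unfolding pattern_after_def agree_def by auto
  then show "\<exists>m. \<forall>\<delta>'. agree m \<delta> \<delta>' \<longrightarrow> \<delta>' \<in> pattern_after n v N" by blast
qed

lemma dense_pattern_after: "\<exists>y. agree m x y \<and> y \<in> pattern_after n v N"
proof -
  \<comment> \<open>This multiple of the factorial is at least \<open>m\<close> and
    \<open>N\<close>, so all prescribed digits lie beyond the prefix to be kept.\<close>
  define l :: nat where "l = fact (n + 1) * (m + N)"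
  define y where "y a = (if a < m then x a else \<not> v ! (a - (l + 1)))" for a
  have "1 * (m + N) \<le> l" unfolding l_def by (intro mult_le_mono1 fact_ge_1)
  then have l: "m \<le> l" "N \<le> l" by simp_all
  then have "y (l + 1 + i) = (\<not> v ! i)" for i by (simp add: y_def)
  moreover have "fact (n + 1) dvd l" unfolding l_def by (rule dvd_triv_left)
  ultimately have "y \<in> pattern_after n v N" using l(2) unfolding pattern_after_def by blast
  moreover have "agree m x y" by (simp add: agree_def y_def)
  ultimately show ?thesis by blast
qed

text \<open>The pattern sets are dense as well as open, so for them genericity becomes
  membership.\<close>

locale generic_point =
  fixes \<gamma> :: cantor
  assumes inner: "generic_for (inner_fails n p i) \<gamma>"
    and outer: "generic_for (halts n q b) \<gamma>"
    and pattern: "\<gamma> \<in> pattern_after n v N"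
begin

lemma proper_block_rev: "proper (\<gamma> \<circ> block_rev j)"
proof -
  have "infinite {a. \<gamma> a}"
    unfolding infinite_nat_iff_unbounded_le
  proof
    fix N
    \<comment> \<open>The one-digit pattern \<open>[False]\<close> forces a digit 1 of
      \<open>\<gamma>\<close> at some position \<open>l + 1\<close> beyond \<open>N\<close>.\<close>
    show "\<exists>a\<ge>N. a \<in> {a. \<gamma> a}"
      using pattern[of 1 "[False]" N] unfolding pattern_after_def by (force intro: exI[of _ "Suc _"])
  qed
  moreover have "{a. \<gamma> a} = block_rev j ` {a. (\<gamma> \<circ> block_rev j) a}"
    by (auto intro!: image_eqI[of _ _ "block_rev j _"])
  ultimately show ?thesis unfolding proper_def by (metis finite_imageI)
qed

lemma all_patterns_near:
  assumes "length v = n"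
  shows "\<exists>\<delta>. agree m \<gamma> \<delta> \<and> map2 cut (diag n \<gamma>) (diag n \<delta>) = v"
proof -
  obtain l where l: "l \<ge> m" "fact (n + 1) dvd l" "\<And>i. i < n \<Longrightarrow> \<gamma> (l + 1 + i) = (\<not> v ! i)"
    using pattern[of n v m] unfolding pattern_after_def by blast
  define \<delta> where "\<delta> a = (if a < l then \<gamma> a else \<not> \<gamma> a)" for a
  have "cut (\<gamma> \<circ> block_rev i) (\<delta> \<circ> block_rev i) = v ! i" if "i < n" for i
  proof -
    have dvd: "(i + 2) dvd l"
      using that by (intro dvd_trans[OF dvd_fact l(2)]) auto
    have "agree l (\<delta> \<circ> block_rev i) (\<gamma> \<circ> block_rev i)"
      using block_rev_less[OF dvd] by (simp add: agree_def \<delta>_def)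
    moreover have "(\<delta> \<circ> block_rev i) l \<noteq> (\<gamma> \<circ> block_rev i) l"
      by (simp add: block_rev_dvd[OF dvd] \<delta>_def)
    ultimately have "cut (\<gamma> \<circ> block_rev i) (\<delta> \<circ> block_rev i) = (\<not> (\<gamma> \<circ> block_rev i) l)"
      by (rule cut_first_diff)
    then show ?thesis using l(3)[OF that] by (simp add: block_rev_dvd[OF dvd])
  qed
  then have "map2 cut (diag n \<gamma>) (diag n \<delta>) = v"
    using assms by (intro nth_equalityI) auto
  moreover have "agree m \<gamma> \<delta>"
    using l(1) by (simp add: agree_def \<delta>_def)
  ultimately show ?thesis by blast
qed

text \<open>If the output at \<open>\<gamma>\<close> equals the \<open>i\<close>-th cut point,
  genericity spreads the equality to a neighbourhood. If it differs, the cut is locally constant at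
  that output, and the output depends continuously on \<open>\<delta>\<close>.\<close>

lemma inner_coord:
  assumes Y: "\<And>\<delta> k. computes (diag n \<delta>) p [i, k] (of_bool (Y \<delta> k))" and "i < n"
  shows "\<exists>m. (\<forall>\<delta>. agree m \<gamma> \<delta> \<longrightarrow> Y \<delta> = \<delta> \<circ> block_rev i) \<or>
    (\<exists>c. \<forall>\<delta>. agree m \<gamma> \<delta> \<longrightarrow> cut (\<gamma> \<circ> block_rev i) (Y \<delta>) = c)"
proof (cases "Y \<gamma> = \<gamma> \<circ> block_rev i")
  case True
  then have "\<gamma> \<notin> inner_fails n p i"
    using Y[of \<gamma>] computes_deterministic unfolding inner_fails_def by fastforce
  with inner obtain m where m: "\<And>\<delta>. agree m \<gamma> \<delta> \<Longrightarrow> \<delta> \<notin> inner_fails n p i"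
    unfolding generic_for_def by blast
  have "Y \<delta> k = \<delta> (block_rev i k)" if "agree m \<gamma> \<delta>" for \<delta> k
    using m[OF that] Y[of \<delta> k] unfolding inner_fails_def by force
  then have "\<forall>\<delta>. agree m \<gamma> \<delta> \<longrightarrow> Y \<delta> = \<delta> \<circ> block_rev i" by auto
  then show ?thesis by blast
next
  case False
  then obtain K where K: "\<And>z. agree K (Y \<gamma>) z \<Longrightarrow> cut (\<gamma> \<circ> block_rev i) z = cut (\<gamma> \<circ> block_rev i) (Y \<gamma>)"
    using cut_locally_constant by blast
  \<comment> \<open>Continuity of \<open>Y\<close> at \<open>\<gamma>\<close>, one output digit at a
    time.\<close>
  have "\<exists>m. \<forall>\<delta>. agree m \<gamma> \<delta> \<longrightarrow> agree K (Y \<gamma>) (Y \<delta>)" for K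
  proof (induction K)
    case (Suc K)
    then obtain m where m: "\<And>\<delta>. agree m \<gamma> \<delta> \<Longrightarrow> agree K (Y \<gamma>) (Y \<delta>)" by blast
    obtain m' where m': "\<And>\<delta>. agree m' \<gamma> \<delta> \<Longrightarrow> computes (diag n \<delta>) p [i, K] (of_bool (Y \<gamma> K))"
      using computes_diag_open[OF Y] by blast
    have "agree (Suc K) (Y \<gamma>) (Y \<delta>)" if "agree (max m m') \<gamma> \<delta>" for \<delta>
    proof -
      have "of_bool (Y \<gamma> K) = (of_bool (Y \<delta> K) :: nat)"
        using that by (intro computes_deterministic[OF m' Y]) (simp add: agree_max)
      then have "Y \<gamma> K = Y \<delta> K" by (simp only: of_bool_eq_iff)
      moreover have "agree K (Y \<gamma>) (Y \<delta>)" using that by (intro m) (simp add: agree_max)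
      ultimately show ?thesis by (auto simp: agree_def less_Suc_eq)
    qed
    then show ?case by blast
  qed (simp add: agree_def)
  then obtain m where "\<forall>\<delta>. agree m \<gamma> \<delta> \<longrightarrow> agree K (Y \<gamma>) (Y \<delta>)" by blast
  with K have "\<forall>\<delta>. agree m \<gamma> \<delta> \<longrightarrow> cut (\<gamma> \<circ> block_rev i) (Y \<delta>) = cut (\<gamma> \<circ> block_rev i) (Y \<gamma>)"
    by blast
  then show ?thesis by blast
qed

text \<open>The outer program need not halt on a bit that the oracle does not return. If it halts at
  \<open>\<gamma>\<close>, its value persists nearby; otherwise genericity excludes halting nearby,
  and the claim is vacuous there.\<close>

lemma outer_bit:
  "\<exists>c m. \<forall>\<delta> g. agree m \<gamma> \<delta> \<longrightarrow> computes (diag n \<delta>) q [b] (of_bool g) \<longrightarrow> g = c"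
  using outer[of n q b] unfolding generic_for_def
proof
  assume "\<gamma> \<in> halts n q b"
  then obtain v where "computes (diag n \<gamma>) q [b] v" by (auto simp: halts_def)
  then obtain m where m: "\<And>\<delta>. agree m \<gamma> \<delta> \<Longrightarrow> computes (diag n \<delta>) q [b] v"
    using computes_diag_open by blast
  have "g = (v = 1)" if "agree m \<gamma> \<delta>" "computes (diag n \<delta>) q [b] (of_bool g)" for \<delta> g
    using computes_deterministic[OF m[OF that(1)] that(2)] by simp
  then show ?thesis by blast
qed (auto simp: halts_def)

lemma common_radius:
  assumes "\<forall>i\<in>{..<n::nat}. \<exists>m. \<forall>\<delta>. agree m \<gamma> \<delta> \<longrightarrow> P i \<delta>"
  shows "\<exists>m. \<forall>\<delta>. agree m \<gamma> \<delta> \<longrightarrow> (\<forall>i\<in>{..<n}. P i \<delta>)"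
  using assms
proof (induction n)
  case (Suc n)
  then obtain m m' where "\<forall>\<delta>. agree m \<gamma> \<delta> \<longrightarrow> (\<forall>i\<in>{..<n}. P i \<delta>)" "\<forall>\<delta>. agree m' \<gamma> \<delta> \<longrightarrow> P n \<delta>"
    by (auto simp: lessThan_Suc)
  then show ?case
    by (intro exI[of _ "max m m'"]) (simp add: lessThan_Suc agree_max)
qed simp

lemma weihrauch_le_factor:
  assumes "weihrauch_le n (tt_cut G (diag n \<gamma>)) (tt_cut F (diag n \<gamma>))"
  shows "\<exists>I c \<psi>. \<forall>v. length v = n \<longrightarrow>
    G v = \<psi> (F (map (\<lambda>i. if i \<in> I then c i else v ! i) [0..<n]))"
proof -
  obtain \<Phi> \<Psi> where \<Phi>: "computable_map n \<Phi>" and \<Psi>: "computable_bit n \<Psi>" and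
    red: "\<And>xs. length xs = n \<Longrightarrow>
      \<exists>ys. \<Phi> xs = Some ys \<and> \<Psi> xs (tt_cut F (diag n \<gamma>) ys) = Some (tt_cut G (diag n \<gamma>) xs)"
    using assms unfolding weihrauch_le_def by blast
  obtain p where p: "\<And>xs ys. length xs = n \<Longrightarrow> \<Phi> xs = Some ys \<Longrightarrow>
     length ys = n \<and> (\<forall>i<n. \<forall>k. computes xs p [i, k] (of_bool ((ys ! i) k)))"
    using \<Phi> unfolding computable_map_def by blast
  obtain q where q: "\<And>xs b c. length xs = n \<Longrightarrow> \<Psi> xs b = Some c \<Longrightarrow> computes xs q [of_bool b] (of_bool c)"
    using \<Psi> unfolding computable_bit_def by blast
  define Y where "Y \<delta> = the (\<Phi> (diag n \<delta>))" for \<delta>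
  have Y: "\<Phi> (diag n \<delta>) = Some (Y \<delta>)"
    and Y\<Psi>: "\<Psi> (diag n \<delta>) (tt_cut F (diag n \<gamma>) (Y \<delta>)) = Some (tt_cut G (diag n \<gamma>) (diag n \<delta>))" for \<delta>
    using red[of "diag n \<delta>"] unfolding Y_def by auto
  have lenY: "length (Y \<delta>) = n" for \<delta>
    using p[OF _ Y] by simp
  \<comment> \<open>The option \<open>s\<close> records the alternative of
    \<open>inner_coord\<close>: \<open>None\<close> for the projection, \<open>Some c\<close> for
    the constant cut value \<open>c\<close>.\<close>
  have "\<forall>i\<in>{..<n}. \<exists>s. \<exists>m. \<forall>\<delta>. agree m \<gamma> \<delta> \<longrightarrow> cut (\<gamma> \<circ> block_rev i) (Y \<delta> ! i) =
      (case s of Some c \<Rightarrow> c | None \<Rightarrow> cut (\<gamma> \<circ> block_rev i) (\<delta> \<circ> block_rev i))"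
  proof
    fix i assume "i \<in> {..<n}"
    then have "\<And>\<delta> k. computes (diag n \<delta>) p [i, k] (of_bool ((Y \<delta> ! i) k))" and "i < n"
      using p[OF _ Y] by auto
    from inner_coord[OF this] obtain m where
      "(\<forall>\<delta>. agree m \<gamma> \<delta> \<longrightarrow> Y \<delta> ! i = \<delta> \<circ> block_rev i) \<or>
        (\<exists>c. \<forall>\<delta>. agree m \<gamma> \<delta> \<longrightarrow> cut (\<gamma> \<circ> block_rev i) (Y \<delta> ! i) = c)"
      by blast
    then show "\<exists>s. \<exists>m. \<forall>\<delta>. agree m \<gamma> \<delta> \<longrightarrow> cut (\<gamma> \<circ> block_rev i) (Y \<delta> ! i) =
      (case s of Some c \<Rightarrow> c | None \<Rightarrow> cut (\<gamma> \<circ> block_rev i) (\<delta> \<circ> block_rev i))"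
    proof (elim disjE exE)
      assume "\<forall>\<delta>. agree m \<gamma> \<delta> \<longrightarrow> Y \<delta> ! i = \<delta> \<circ> block_rev i"
      then show ?thesis by (intro exI[of _ None] exI[of _ m]) simp
    next
      fix c assume "\<forall>\<delta>. agree m \<gamma> \<delta> \<longrightarrow> cut (\<gamma> \<circ> block_rev i) (Y \<delta> ! i) = c"
      then show ?thesis by (intro exI[of _ "Some c"] exI[of _ m]) simp
    qed
  qed
  from bchoice[OF this] obtain s where "\<forall>i\<in>{..<n}. \<exists>m. \<forall>\<delta>. agree m \<gamma> \<delta> \<longrightarrow>
      cut (\<gamma> \<circ> block_rev i) (Y \<delta> ! i) =
      (case s i of Some c \<Rightarrow> c | None \<Rightarrow> cut (\<gamma> \<circ> block_rev i) (\<delta> \<circ> block_rev i))" ..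
  from common_radius[OF this] obtain m where m: "\<forall>\<delta>. agree m \<gamma> \<delta> \<longrightarrow> (\<forall>i\<in>{..<n}.
      cut (\<gamma> \<circ> block_rev i) (Y \<delta> ! i) =
      (case s i of Some c \<Rightarrow> c | None \<Rightarrow> cut (\<gamma> \<circ> block_rev i) (\<delta> \<circ> block_rev i)))" ..
  define I where "I = {i. s i \<noteq> None}"
  define c where "c i = the (s i)" for i
  have cutY: "map2 cut (diag n \<gamma>) (Y \<delta>) =
      map (\<lambda>i. if i \<in> I then c i else map2 cut (diag n \<gamma>) (diag n \<delta>) ! i) [0..<n]"
    if "agree m \<gamma> \<delta>" for \<delta>
  proof (rule nth_equalityI)
    fix i assume "i < length (map2 cut (diag n \<gamma>) (Y \<delta>))"
    then have "i < n" by (simp add: lenY)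
    have "cut (\<gamma> \<circ> block_rev i) (Y \<delta> ! i) =
        (case s i of Some c \<Rightarrow> c | None \<Rightarrow> cut (\<gamma> \<circ> block_rev i) (\<delta> \<circ> block_rev i))"
      using m that \<open>i < n\<close> by blast
    then show "map2 cut (diag n \<gamma>) (Y \<delta>) ! i =
        map (\<lambda>i. if i \<in> I then c i else map2 cut (diag n \<gamma>) (diag n \<delta>) ! i) [0..<n] ! i"
      using \<open>i < n\<close> by (cases "s i") (simp_all add: lenY I_def c_def)
  qed (simp add: lenY)
  have "\<forall>b. \<exists>e. \<exists>m. \<forall>\<delta> g. agree m \<gamma> \<delta> \<longrightarrow> computes (diag n \<delta>) q [of_bool b] (of_bool g) \<longrightarrow> g = e"
    by (rule allI) (rule outer_bit)
  from choice[OF this] obtain \<psi> where "\<forall>b. \<exists>m. \<forall>\<delta> g. agree m \<gamma> \<delta> \<longrightarrow>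
      computes (diag n \<delta>) q [of_bool b] (of_bool g) \<longrightarrow> g = \<psi> b" ..
  from choice[OF this] obtain r where r: "\<And>b \<delta> g. agree (r b) \<gamma> \<delta> \<Longrightarrow>
      computes (diag n \<delta>) q [of_bool b] (of_bool g) \<Longrightarrow> g = \<psi> b"
    by blast
  have "G v = \<psi> (F (map (\<lambda>i. if i \<in> I then c i else v ! i) [0..<n]))" if "length v = n" for v
  proof -
    \<comment> \<open>One point close enough for the inner and both outer radii that realises the
      pattern \<open>v\<close>; evaluating the reduction there gives the equation for
      \<open>v\<close>.\<close>
    obtain \<delta> where \<delta>: "agree (max m (max (r True) (r False))) \<gamma> \<delta>"
      "map2 cut (diag n \<gamma>) (diag n \<delta>) = v"
      using all_patterns_near[OF \<open>length v = n\<close>] by blast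
    then have "agree m \<gamma> \<delta>" by (simp add: agree_max)
    have r\<delta>: "agree (r b) \<gamma> \<delta>" for b
      using \<delta>(1) by (cases b) (simp_all add: agree_max)
    have "G v = tt_cut G (diag n \<gamma>) (diag n \<delta>)"
      by (simp add: tt_cut_def \<delta>(2))
    also have "\<dots> = \<psi> (tt_cut F (diag n \<gamma>) (Y \<delta>))"
      by (rule r[OF r\<delta> q[OF _ Y\<Psi>]]) simp
    also have "\<dots> = \<psi> (F (map (\<lambda>i. if i \<in> I then c i else v ! i) [0..<n]))"
      by (simp add: tt_cut_def cutY[OF \<open>agree m \<gamma> \<delta>\<close>] \<delta>(2))
    finally show ?thesis .
  qed
  then show ?thesis by blast
qed

end

section \<open>From factorizations to restrictions of truth-tables\<close>

lemma tt_fix_filter: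
  assumes "length v = n"
  shows "tt_fix F (filter P [0..<n]) (map c (filter P [0..<n])) v =
    F (map (\<lambda>i. if P i then c i else v ! i) [0..<n])"
proof -
  \<comment> \<open>The inserted value is a function of the index, so neither order nor repetition
    in \<open>js\<close> affects the result.\<close>
  have "foldr (\<lambda>(i, b). set_coord i b) (zip js (map c js)) v =
      map (\<lambda>i. if i \<in> set js then c i else v ! i) [0..<n]" for js
  proof (induction js)
    case Nil
    then show ?case by (simp add: map_nth flip: assms)
  next
    case (Cons j js)
    have "foldr (\<lambda>(i, b). set_coord i b) (zip (j # js) (map c (j # js))) v =
        (map (\<lambda>i. if i \<in> set js then c i else v ! i) [0..<n])[j := c j]"
      by (simp add: Cons set_coord_def)
    also have "\<dots> = map (\<lambda>i. if i \<in> set (j # js) then c i else v ! i) [0..<n]"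
    proof (rule nth_equalityI)
      fix i assume "i < length ((map (\<lambda>i. if i \<in> set js then c i else v ! i) [0..<n])[j := c j])"
      then show "(map (\<lambda>i. if i \<in> set js then c i else v ! i) [0..<n])[j := c j] ! i =
          map (\<lambda>i. if i \<in> set (j # js) then c i else v ! i) [0..<n] ! i"
        by (cases "j = i") simp_all
    qed simp
    finally show ?case .
  qed
  moreover have "map (\<lambda>i. if i \<in> set (filter P [0..<n]) then c i else v ! i) [0..<n] =
      map (\<lambda>i. if P i then c i else v ! i) [0..<n]"
    by (rule map_cong) auto
  ultimately show ?thesis unfolding tt_fix_def by (simp only:)
qed

lemma bool_unary_cases:
  obtains "\<psi> = (\<lambda>b. b)" | "\<psi> = Not" | c where "\<psi> = (\<lambda>_ :: bool. c :: bool)"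
proof -
  have ext: "\<psi> = f" if "\<psi> True = f True" "\<psi> False = f False" for f
  proof
    show "\<psi> b = f b" for b using that by (cases b) simp_all
  qed
  consider "\<psi> True" "\<not> \<psi> False" | "\<not> \<psi> True" "\<psi> False" | "\<psi> True = \<psi> False" by blast
  then show thesis
  proof cases
    case 1
    then show thesis by (intro that(1) ext) simp_all
  next
    case 2
    then show thesis by (intro that(2) ext) simp_all
  next
    case 3
    then show thesis by (intro that(3)[of "\<psi> False"] ext) simp_all
  qed
qed

lemma factor_imp_tt_fix:
  assumes "\<And>v. length v = n \<Longrightarrow> G v = \<psi> (F (map (\<lambda>i. if i \<in> I then c i else v ! i) [0..<n]))"
  shows "\<exists>k ivec bvec. length ivec = k \<and> length bvec = k \<and> set ivec \<subseteq> {..<n} \<and> distinct ivec \<and>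
     ((\<forall>v. length v = n \<longrightarrow> G v = tt_fix F ivec bvec v) \<or>
      (\<forall>v. length v = n \<longrightarrow> G v = (\<not> tt_fix F ivec bvec v)))"
proof -
  have *: ?thesis if "(\<forall>v. length v = n \<longrightarrow> G v = tt_fix F (filter P [0..<n]) (map d (filter P [0..<n])) v) \<or>
      (\<forall>v. length v = n \<longrightarrow> G v = (\<not> tt_fix F (filter P [0..<n]) (map d (filter P [0..<n])) v))" for P d
    by (intro exI[of _ "length (filter P [0..<n])"] exI[of _ "filter P [0..<n]"]
      exI[of _ "map d (filter P [0..<n])"] conjI that) auto
  show ?thesis
  proof (cases \<psi> rule: bool_unary_cases)
    case 1
    then have "\<forall>v. length v = n \<longrightarrow>
        G v = tt_fix F (filter (\<lambda>i. i \<in> I) [0..<n]) (map c (filter (\<lambda>i. i \<in> I) [0..<n])) v"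
      by (simp add: tt_fix_filter assms)
    then show ?thesis by (intro *[of "\<lambda>i. i \<in> I" c] disjI1)
  next
    case 2
    then have "\<forall>v. length v = n \<longrightarrow>
        G v = (\<not> tt_fix F (filter (\<lambda>i. i \<in> I) [0..<n]) (map c (filter (\<lambda>i. i \<in> I) [0..<n])) v)"
      by (simp add: tt_fix_filter assms)
    then show ?thesis by (intro *[of "\<lambda>i. i \<in> I" c] disjI2)
  next
    case (3 e)
    then have G: "G v = e" if "length v = n" for v
      using assms[OF that] by simp
    \<comment> \<open>For constant \<open>\<psi>\<close>, fixing all coordinates makes the
      restriction of \<open>F\<close> constant too, so \<open>G\<close> is that restriction or its
      negation.\<close>
    have F: "tt_fix F (filter (\<lambda>_. True) [0..<n]) (map c (filter (\<lambda>_. True) [0..<n])) v = F (map c [0..<n])"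
      if "length v = n" for v
      using tt_fix_filter[OF that, of F "\<lambda>_. True" c] by simp
    show ?thesis
    proof (rule *[of "\<lambda>_. True" c], cases "F (map c [0..<n]) = e")
      case True
      with F G show "(\<forall>v. length v = n \<longrightarrow>
            G v = tt_fix F (filter (\<lambda>_. True) [0..<n]) (map c (filter (\<lambda>_. True) [0..<n])) v) \<or>
          (\<forall>v. length v = n \<longrightarrow>
            G v = (\<not> tt_fix F (filter (\<lambda>_. True) [0..<n]) (map c (filter (\<lambda>_. True) [0..<n])) v))"
        by blast
    next
      case False
      with F G show "(\<forall>v. length v = n \<longrightarrow>
            G v = tt_fix F (filter (\<lambda>_. True) [0..<n]) (map c (filter (\<lambda>_. True) [0..<n])) v) \<or>
          (\<forall>v. length v = n \<longrightarrow>
            G v = (\<not> tt_fix F (filter (\<lambda>_. True) [0..<n]) (map c (filter (\<lambda>_. True) [0..<n])) v))"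
        by blast
    qed
  qed
qed

section \<open>Existence of a generic point and the final equivalence\<close>

lemma generic_point_exists: "\<exists>\<gamma>. generic_point \<gamma>"
proof -
  define \<U> where "\<U> = range (\<lambda>(n, p, i). inner_fails n p i) \<union> range (\<lambda>(n, q, b). halts n q b)
    \<union> range (\<lambda>(n, v, N). pattern_after n v N)"
  have "countable \<U>" unfolding \<U>_def by simp
  moreover have "cantor_open U" if "U \<in> \<U>" for U
    using that open_inner_fails open_halts open_pattern_after unfolding \<U>_def by auto
  ultimately obtain \<gamma> where \<gamma>: "\<And>U. U \<in> \<U> \<Longrightarrow> generic_for U \<gamma>"
    using generic_exists by meson
  have "generic_point \<gamma>"
  proof
    show "generic_for (inner_fails n p i) \<gamma>" for n p i
      by (rule \<gamma>) (auto simp: \<U>_def intro: image_eqI[of _ _ "(n, p, i)"])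
    show "generic_for (halts n q b) \<gamma>" for n q b
      by (rule \<gamma>) (auto simp: \<U>_def intro: image_eqI[of _ _ "(n, q, b)"])
    have "generic_for (pattern_after n v N) \<gamma>" for n v N
      by (rule \<gamma>) (auto simp: \<U>_def intro: image_eqI[of _ _ "(n, v, N)"])
    \<comment> \<open>Density rules out a neighbourhood of \<open>\<gamma>\<close> disjoint from the
      set.\<close>
    then show "\<gamma> \<in> pattern_after n v N" for n v N
      using dense_pattern_after unfolding generic_for_def by blast
  qed
  then show ?thesis by blast
qed

theorem mainTheorem5:
  "\<exists>\<beta> :: nat \<Rightarrow> cantor.
     (\<forall>j. proper (\<beta> j)) \<and>
     (\<forall>n>0. \<forall>F G :: bool list \<Rightarrow> bool.
        let sF = tt_cut F (map \<beta> [0..<n]); sG = tt_cut G (map \<beta> [0..<n]) in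
        (strong_weihrauch_le n sG sF \<longleftrightarrow> weihrauch_le n sG sF) \<and>
        (weihrauch_le n sG sF \<longleftrightarrow>
          (\<exists>k ivec bvec. length ivec = k \<and> length bvec = k \<and> set ivec \<subseteq> {..<n} \<and> distinct ivec \<and>
             ((\<forall>v. length v = n \<longrightarrow> G v = tt_fix F ivec bvec v) \<or>
              (\<forall>v. length v = n \<longrightarrow> G v = (\<not> tt_fix F ivec bvec v)))))) \<and>
     (\<forall>j k. one_equiv {a. \<beta> j a} {a. \<beta> k a})"
proof -
  obtain \<gamma> where "generic_point \<gamma>" using generic_point_exists ..
  then interpret generic_point \<gamma> .
  have restriction: "\<exists>k ivec bvec. length ivec = k \<and> length bvec = k \<and> set ivec \<subseteq> {..<n} \<and> distinct ivec \<and>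
     ((\<forall>v. length v = n \<longrightarrow> G v = tt_fix F ivec bvec v) \<or>
      (\<forall>v. length v = n \<longrightarrow> G v = (\<not> tt_fix F ivec bvec v)))"
    if "weihrauch_le n (tt_cut G (diag n \<gamma>)) (tt_cut F (diag n \<gamma>))" for n F G
  proof -
    obtain I c \<psi> where
      "\<forall>v. length v = n \<longrightarrow> G v = \<psi> (F (map (\<lambda>i. if i \<in> I then c i else v ! i) [0..<n]))"
      using weihrauch_le_factor[OF \<open>weihrauch_le _ _ _\<close>] by (elim exE)
    then show ?thesis by (intro factor_imp_tt_fix) simp
  qed
  have strong: "strong_weihrauch_le n (tt_cut G (diag n \<gamma>)) (tt_cut F (diag n \<gamma>))"
    if "(\<forall>v. length v = n \<longrightarrow> G v = tt_fix F ivec bvec v) \<or>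
      (\<forall>v. length v = n \<longrightarrow> G v = (\<not> tt_fix F ivec bvec v))" for n F G ivec bvec
    by (rule tt_fix_imp_strong_weihrauch_le[OF _ _ that]) (simp_all add: proper_block_rev)
  define \<beta> where "\<beta> j = \<gamma> \<circ> block_rev j" for j
  have diag: "map \<beta> [0..<n] = diag n \<gamma>" for n
    by (simp add: diag_def \<beta>_def)
  have equiv: "(strong_weihrauch_le n sG sF \<longleftrightarrow> weihrauch_le n sG sF) \<and>
        (weihrauch_le n sG sF \<longleftrightarrow>
          (\<exists>k ivec bvec. length ivec = k \<and> length bvec = k \<and> set ivec \<subseteq> {..<n} \<and> distinct ivec \<and>
             ((\<forall>v. length v = n \<longrightarrow> G v = tt_fix F ivec bvec v) \<or>
              (\<forall>v. length v = n \<longrightarrow> G v = (\<not> tt_fix F ivec bvec v)))))" (is "_ \<and> (_ \<longleftrightarrow> ?R)")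
    if "sF = tt_cut F (map \<beta> [0..<n])" "sG = tt_cut G (map \<beta> [0..<n])" for n F G sF sG
  proof -
    \<comment> \<open>The equivalences follow from a cycle: a Weihrauch reduction gives a
      restriction, which gives a strong reduction, which is a Weihrauch reduction.\<close>
    have "weihrauch_le n sG sF \<Longrightarrow> ?R"
      unfolding that diag by (rule restriction)
    moreover have "?R \<Longrightarrow> strong_weihrauch_le n sG sF"
      unfolding that diag by (elim exE conjE) (rule strong)
    ultimately show ?thesis
      using strong_weihrauch_le_imp_weihrauch_le[of n sG sF] by argo
  qed
  show ?thesis
    unfolding Let_def
  proof (rule exI[of _ \<beta>], intro conjI)
    show "\<forall>j. proper (\<beta> j)"
      unfolding \<beta>_def using proper_block_rev by blast
    show "\<forall>j k. one_equiv {a. \<beta> j a} {a. \<beta> k a}"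
      unfolding \<beta>_def using one_equiv_block_rev by blast
  qed (intro allI impI equiv refl)
qed

end
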